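(* Let $\sigma,\mu>0$ and $T>0$, and let $(h,v)$ be a classical positive solution (i.e. with $h>0$) on $r\in(0,1)$, $t\in(0,T)$ of the system $$v_t+vv_r=\sigma\Big(\frac1r\,[r h_r]_r\Big)_r+\frac{4\mu}{h}\left(\Big[\frac hr (rv)_r\Big]_r-\frac{v h_r}{2r}\right),\qquad h_t=-\frac{(rhv)_r}{r},$$ with boundary conditions $h_r(0,t)=h_r(1,t)=v(0,t)=v(1,t)=0$ and initial data $(h_0,v_0)$. Then the following energy and entropy inequalities hold: $$\frac{d}{dt}\int_0^1\left[\frac{hv^2}{2}+\sigma\frac{|h_r|^2}{2}\right]r\,dr\leqslant-2\mu\int_0^1\frac{h\,|(vr)_r|^2}{r}\,dr,$$ $$\frac{d}{dt}\int_0^1\left[\frac h2\left(v+4\mu\frac{h_r}{h}\right)^2+\sigma\frac{|h_r|^2}{2}\right]r\,dr\leqslant-2\mu\sigma\int_0^1\frac{|(rh_r)_r|^2}{r}\,dr+\frac{C}{\mu\sigma m^3}\int_0^1\frac{hv^2}{r}\,dr,$$ provided $$h(r,t)\geqslant m>0\qquad\text{for all } r\in(0,1),\ t\in[0,T).$$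
   Context: The system is the radially symmetric reduction, with $r=\sqrt{x^2+y^2}$, of the two-dimensional viscous sheet system on the unit disc; $h$ is the height, $v$ the radial velocity, $\sigma$ the surface tension and $\mu$ the viscosity. The letter $C$ denotes a generic positive constant depending only on $\sigma$, $\mu$ and the initial data $(h_0,v_0)$ (in particular not on $m$, $t$ or $T$). *)

theory Defs
  imports "HOL-Analysis.Analysis"
begin

text \<open>
  A quantity depending on radius and time is a function \<open>f r t\<close>; only its values for
  \<open>0 \<le> r \<le> 1\<close> and \<open>0 \<le> t < T\<close> matter. The radial derivative is relative to the closed interval,
  so it is the one-sided derivative at \<open>r = 0\<close> and \<open>r = 1\<close>.
\<close>

definition dr :: "(real \<Rightarrow> real \<Rightarrow> real) \<Rightarrow> real \<Rightarrow> real \<Rightarrow> real" where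
  "dr f r t = vector_derivative (\<lambda>\<rho>. f \<rho> t) (at r within {0..1})"

definition dt :: "(real \<Rightarrow> real \<Rightarrow> real) \<Rightarrow> real \<Rightarrow> real \<Rightarrow> real" where
  "dt f r t = deriv (\<lambda>\<tau>. f r \<tau>) t"

definition continuous_rt :: "real set \<Rightarrow> (real \<Rightarrow> real \<Rightarrow> real) \<Rightarrow> bool" where
  "continuous_rt I f \<longleftrightarrow> continuous_on ({0..1} \<times> I) (\<lambda>(r, t). f r t)"

definition differentiable_r :: "real set \<Rightarrow> (real \<Rightarrow> real \<Rightarrow> real) \<Rightarrow> bool" where
  "differentiable_r I f \<longleftrightarrow>
     (\<forall>t\<in>I. \<forall>r\<in>{0..1}. (\<lambda>\<rho>. f \<rho> t) differentiable (at r within {0..1}))"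

definition differentiable_t :: "real set \<Rightarrow> (real \<Rightarrow> real \<Rightarrow> real) \<Rightarrow> bool" where
  "differentiable_t I f \<longleftrightarrow>
     (\<forall>t\<in>I. \<forall>r\<in>{0..1}. (\<lambda>\<tau>. f r \<tau>) differentiable (at t))"

text \<open>Derivatives in \<open>r\<close> up to order \<open>k\<close> and the first derivative in \<open>t\<close> exist and are jointly
  continuous on \<open>[0,1] \<times> I\<close>.\<close>

definition regular_rt :: "nat \<Rightarrow> real set \<Rightarrow> (real \<Rightarrow> real \<Rightarrow> real) \<Rightarrow> bool" where
  "regular_rt k I f \<longleftrightarrow>
     (\<forall>i<k. differentiable_r I ((dr ^^ i) f)) \<and>
     (\<forall>i\<le>k. continuous_rt I ((dr ^^ i) f)) \<and>
     differentiable_t I f \<and> continuous_rt I (dt f)"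

definition momentum_eq :: "real \<Rightarrow> real \<Rightarrow> (real \<Rightarrow> real \<Rightarrow> real) \<Rightarrow> (real \<Rightarrow> real \<Rightarrow> real) \<Rightarrow>
    real \<Rightarrow> real \<Rightarrow> bool" where
  "momentum_eq \<sigma> \<mu> h v r t \<longleftrightarrow>
     dt v r t + v r t * dr v r t =
       \<sigma> * dr (\<lambda>r t. 1 / r * dr (\<lambda>r t. r * dr h r t) r t) r t
       + 4 * \<mu> / h r t *
           (dr (\<lambda>r t. h r t / r * dr (\<lambda>r t. r * v r t) r t) r t
            - v r t * dr h r t / (2 * r))"

definition mass_eq :: "(real \<Rightarrow> real \<Rightarrow> real) \<Rightarrow> (real \<Rightarrow> real \<Rightarrow> real) \<Rightarrow> real \<Rightarrow> real \<Rightarrow> bool" where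
  "mass_eq h v r t \<longleftrightarrow> dt h r t = - dr (\<lambda>r t. r * h r t * v r t) r t / r"

text \<open>
  Classical positive solutions: all derivatives occurring in the system are continuous up to the
  spatial boundary for positive times, and the data are attained with \<open>h\<close>, \<open>h\<^sub>r\<close>, \<open>v\<close> continuous
  down to \<open>t = 0\<close>. The latter ties the energy, which involves just these three functions, to the
  initial data.
\<close>

definition classical_positive_solution ::
  "real \<Rightarrow> real \<Rightarrow> real \<Rightarrow> (real \<Rightarrow> real) \<Rightarrow> (real \<Rightarrow> real) \<Rightarrow>
   (real \<Rightarrow> real \<Rightarrow> real) \<Rightarrow> (real \<Rightarrow> real \<Rightarrow> real) \<Rightarrow> bool" where
  "classical_positive_solution \<sigma> \<mu> T h0 v0 h v \<longleftrightarrow>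
     regular_rt 3 {0<..<T} h \<and> regular_rt 2 {0<..<T} v \<and>
     continuous_rt {0..<T} h \<and> continuous_rt {0..<T} v \<and>
     differentiable_r {0..<T} h \<and> continuous_rt {0..<T} (dr h) \<and>
     (\<forall>r\<in>{0<..<1}. \<forall>t\<in>{0<..<T}. h r t > 0 \<and> momentum_eq \<sigma> \<mu> h v r t \<and> mass_eq h v r t) \<and>
     (\<forall>t\<in>{0<..<T}. dr h 0 t = 0 \<and> dr h 1 t = 0 \<and> v 0 t = 0 \<and> v 1 t = 0) \<and>
     (\<forall>r\<in>{0..1}. h r 0 = h0 r \<and> v r 0 = v0 r)"

text \<open>
  Integrands of the functionals, including the weight. Where they contain a division by \<open>r\<close>, the
  value at the single point \<open>r = 0\<close> is irrelevant for the integrals over \<open>[0,1]\<close>.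
\<close>

definition energy_density ::
  "real \<Rightarrow> (real \<Rightarrow> real \<Rightarrow> real) \<Rightarrow> (real \<Rightarrow> real \<Rightarrow> real) \<Rightarrow> real \<Rightarrow> real \<Rightarrow> real" where
  "energy_density \<sigma> h v t r =
     (h r t * (v r t)\<^sup>2 / 2 + \<sigma> * \<bar>dr h r t\<bar>\<^sup>2 / 2) * r"

definition entropy_density ::
  "real \<Rightarrow> real \<Rightarrow> (real \<Rightarrow> real \<Rightarrow> real) \<Rightarrow> (real \<Rightarrow> real \<Rightarrow> real) \<Rightarrow> real \<Rightarrow> real \<Rightarrow> real" where
  "entropy_density \<sigma> \<mu> h v t r =
     (h r t / 2 * (v r t + 4 * \<mu> * (dr h r t / h r t))\<^sup>2 + \<sigma> * \<bar>dr h r t\<bar>\<^sup>2 / 2) * r"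

definition viscous_dissipation ::
  "(real \<Rightarrow> real \<Rightarrow> real) \<Rightarrow> (real \<Rightarrow> real \<Rightarrow> real) \<Rightarrow> real \<Rightarrow> real \<Rightarrow> real" where
  "viscous_dissipation h v t r = h r t * \<bar>dr (\<lambda>r t. v r t * r) r t\<bar>\<^sup>2 / r"

definition capillary_dissipation :: "(real \<Rightarrow> real \<Rightarrow> real) \<Rightarrow> real \<Rightarrow> real \<Rightarrow> real" where
  "capillary_dissipation h t r = \<bar>dr (\<lambda>r t. r * dr h r t) r t\<bar>\<^sup>2 / r"

definition remainder_density ::
  "(real \<Rightarrow> real \<Rightarrow> real) \<Rightarrow> (real \<Rightarrow> real \<Rightarrow> real) \<Rightarrow> real \<Rightarrow> real \<Rightarrow> real" where
  "remainder_density h v t r = h r t * (v r t)\<^sup>2 / r"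

end

theory Submission
  imports Defs
begin

text \<open>
  Both inequalities come from balance laws in divergence form. With \<open>D = (r h\<^sub>r)\<^sub>r\<close>, each weighted
  density has a time derivative that is, for \<open>0 < r < 1\<close>, the \<open>r\<close>-derivative of an explicit flux plus
  dissipation and source terms. The flux is continuous on \<open>[0,1]\<close> and vanishes at both ends because
  \<open>v\<close> and \<open>h\<^sub>r\<close> do, so integrating in \<open>r\<close> leaves only the other terms.

  For the energy (\<open>energy_flux_deriv\<close>), writing \<open>2 v v\<^sub>r = ((r v)\<^sub>r)\<^sup>2 / r - v\<^sup>2 / r - r v\<^sub>r\<^sup>2\<close> shows that
  the viscous term \<open>- 4 \<mu> h ((r v)\<^sub>r)\<^sup>2 / r + 4 \<mu> h v v\<^sub>r\<close> equals \<open>- 2 \<mu> h ((r v)\<^sub>r)\<^sup>2 / r\<close> minus the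
  nonnegative quantity \<open>2 \<mu> h (v\<^sup>2 / r + r v\<^sub>r\<^sup>2)\<close>.

  For the entropy (\<open>entropy_flux_deriv\<close>), the mass equation yields an equation for \<open>(ln h)\<^sub>r\<close> whose second
  derivatives of \<open>v\<close> cancel the viscous ones: \<open>u = v + 4 \<mu> h\<^sub>r / h\<close> satisfies
  \<open>h (u\<^sub>t + v u\<^sub>r) = \<sigma> h (D / r)\<^sub>r + 2 \<mu> h\<^sub>r v / r\<close>. Testing with \<open>r u\<close> gives the dissipation
  \<open>4 \<mu> \<sigma> Y\<close>, where \<open>Y\<close> is the integral of \<open>D\<^sup>2 / r\<close>, and the source
  \<open>2 \<mu> h\<^sub>r v\<^sup>2 + 8 \<mu>\<^sup>2 v h\<^sub>r\<^sup>2 / h\<close>. Half of the dissipation absorbs the source up to the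
  remainder. Indeed, a radial
  interpolation inequality (\<open>radial_interpolation\<close>) bounds \<open>r h\<^sub>r\<^sup>2\<close> pointwise and \<open>h\<^sub>r\<^sup>2\<close> in mean by
  one number \<open>J\<close>, with \<open>J\<^sup>2 \<le> 4 X Y\<close> and \<open>X\<close> the integral of \<open>r h\<^sub>r\<^sup>2\<close>. The energy inequality keeps
  \<open>X\<close> and the kinetic energy below a multiple of the initial energy, so \<open>J\<^sup>2\<close> is at most a constant
  times \<open>Y\<close>, and Young's inequality leaves a multiple of the integral of \<open>h v\<^sup>2 / r\<close>
  (\<open>source_bound\<close>, \<open>source_le\<close>). The first source term needs only a power of \<open>1 / m\<close> lower than the
  third; since \<open>m \<le> h\<^sub>0(1/2)\<close>, it can be raised to \<open>1 / m\<^sup>3\<close> at the price of a constant that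
  depends on the data.

  Analytically, the delicate point is differentiating \<open>h\<^sub>r\<close> in time: the mixed derivative is not part of
  the regularity of the solution. It is recovered from the mass equation (\<open>h1_increment\<close>,
  \<open>deriv_t_h1\<close>), and the factor \<open>r\<close> in \<open>r h\<^sub>r\<close> keeps it continuous up to the centre.
\<close>

section \<open>Radial and time derivatives\<close>

lemmas has_vector_derivative_iff_real = has_real_derivative_iff_has_vector_derivative[symmetric]

lemma dr_eqI:
  assumes "r \<in> {0..1}" "((\<lambda>\<rho>. f \<rho> t) has_real_derivative D) (at r within {0..1})"
  shows "dr f r t = D"
  unfolding dr_def using assms
  by (intro vector_derivative_within_closed_interval) (auto simp: has_vector_derivative_iff_real)

lemma has_real_derivative_dr:
  assumes "differentiable_r I f" "t \<in> I" "r \<in> {0..1}"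
  shows "((\<lambda>\<rho>. f \<rho> t) has_real_derivative dr f r t) (at r within {0..1})"
  using assms unfolding differentiable_r_def dr_def
  by (simp add: vector_derivative_works flip: has_vector_derivative_iff_real)

lemma has_real_derivative_dt:
  assumes "differentiable_t I f" "t \<in> I" "r \<in> {0..1}"
  shows "((\<lambda>\<tau>. f r \<tau>) has_real_derivative dt f r t) (at t)"
  using assms unfolding differentiable_t_def dt_def
  by (meson DERIV_deriv_iff_real_differentiable)

lemma continuous_rt_compose:
  assumes "continuous_rt I f" "continuous_on S a" "continuous_on S b"
    "\<And>x. x \<in> S \<Longrightarrow> a x \<in> {0..1}" "\<And>x. x \<in> S \<Longrightarrow> b x \<in> I"
  shows "continuous_on S (\<lambda>x. f (a x) (b x))"
  using continuous_on_compose2[OF assms(1)[unfolded continuous_rt_def] continuous_on_Pair[OF assms(2,3)]]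
    assms(4,5)
  by (simp add: image_subset_iff)

lemma continuous_rtI:
  assumes "continuous_on ({0..1} \<times> I) (\<lambda>x. f (fst x) (snd x))"
  shows "continuous_rt I f"
  using assms by (simp add: continuous_rt_def case_prod_beta')

lemma has_real_derivative_integral:
  fixes f f' :: "real \<Rightarrow> real \<Rightarrow> real"
  assumes "\<And>s r. s \<in> {0<..<T} \<Longrightarrow> r \<in> {0..1} \<Longrightarrow> ((\<lambda>s. f s r) has_real_derivative f' s r) (at s)"
    and "\<And>s. s \<in> {0<..<T} \<Longrightarrow> continuous_on {0..1} (f s)"
    and "continuous_on ({0<..<T} \<times> {0..1}) (\<lambda>x. f' (fst x) (snd x))"
    and t: "t \<in> {0<..<T}"
  shows "((\<lambda>s. integral {0..1} (f s)) has_real_derivative integral {0..1} (f' t)) (at t)"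
proof -
  have "((\<lambda>s. integral (cbox 0 1) (f s)) has_field_derivative integral (cbox 0 1) (f' t))
          (at t within {0<..<T})"
  proof (rule leibniz_rule_field_derivative)
    show "((\<lambda>s. f s r) has_real_derivative f' s r) (at s within {0<..<T})"
      if "s \<in> {0<..<T}" "r \<in> cbox 0 1" for s r
      by (rule has_field_derivative_at_within, rule assms(1)) (use that in simp_all)
    show "f s integrable_on cbox 0 1" if "s \<in> {0<..<T}" for s
      unfolding cbox_interval by (rule integrable_continuous_real[OF assms(2)[OF that]])
    show "continuous_on ({0<..<T} \<times> cbox 0 1) (\<lambda>(s, r). f' s r)"
      unfolding cbox_interval case_prod_beta' by (rule assms(3))
    show "convex {0<..<T}" by (rule convex_real_interval)
  qed (rule t)
  then show ?thesis
    unfolding at_within_open[OF t open_greaterThanLessThan] cbox_interval .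
qed

text \<open>The quotient \<open>f r t / r\<close>, extended to the centre of the disc by its limit when \<open>f\<close> vanishes there.\<close>

definition slope :: "(real \<Rightarrow> real \<Rightarrow> real) \<Rightarrow> real \<Rightarrow> real \<Rightarrow> real" where
  "slope f r t = (if r = 0 then dr f 0 t else f r t / r)"

lemma mult_slope: "f 0 t = 0 \<Longrightarrow> r * slope f r t = f r t"
  by (simp add: slope_def)

text \<open>
  Rescaling the integral of \<open>dr f\<close> over \<open>[0,r]\<close> to the unit interval removes the division by \<open>r\<close>;
  this is what makes the quotient jointly continuous in \<open>r\<close> and \<open>t\<close> at \<open>r = 0\<close>.
\<close>

lemma slope_eq_integral:
  assumes "differentiable_r I f" "t \<in> I" "f 0 t = 0" "r \<in> {0..1}"
  shows "slope f r t = integral {0..1} (\<lambda>\<theta>. dr f (\<theta> * r) t)"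
proof (cases "r = 0")
  case True
  then show ?thesis by (simp add: slope_def)
next
  case False
  have "((\<lambda>\<theta>. r * dr f (\<theta> * r) t) has_integral f (1 * r) t - f (0 * r) t) {0..1}"
  proof (rule fundamental_theorem_of_calculus)
    fix \<theta> :: real assume \<theta>: "\<theta> \<in> {0..1}"
    have "\<theta> * r \<in> {0..1}"
      using \<theta> assms by (auto simp: mult_le_one)
    from has_real_derivative_dr[OF assms(1,2) this]
    have "((\<lambda>\<rho>. f \<rho> t) has_real_derivative dr f (\<theta> * r) t) (at (\<theta> * r) within (\<lambda>\<theta>. \<theta> * r) ` {0..1})"
      using assms by (rule_tac DERIV_subset) (auto simp: mult_le_one)
    then have "((\<lambda>\<theta>. f (\<theta> * r) t) has_real_derivative dr f (\<theta> * r) t * r) (at \<theta> within {0..1})"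
      by (rule DERIV_image_chain[unfolded o_def]) (auto intro!: derivative_eq_intros)
    then show "((\<lambda>\<theta>. f (\<theta> * r) t) has_vector_derivative r * dr f (\<theta> * r) t) (at \<theta> within {0..1})"
      by (simp add: has_vector_derivative_iff_real mult.commute)
  qed simp
  then have "((\<lambda>\<theta>. 1 / r * (r * dr f (\<theta> * r) t)) has_integral 1 / r * f r t) {0..1}"
    using assms(3) by (intro has_integral_mult_right) simp
  then show ?thesis
    using False by (simp add: slope_def integral_unique)
qed

lemma continuous_rt_slope:
  assumes "differentiable_r I f" "continuous_rt I (dr f)" "\<And>t. t \<in> I \<Longrightarrow> f 0 t = 0"
  shows "continuous_rt I (slope f)"
proof (rule continuous_rtI)
  have "continuous_on (({0..1} \<times> I) \<times> cbox 0 1)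
          (\<lambda>(x, \<theta>). dr f (\<theta> * fst x) (snd x))"
    unfolding case_prod_beta'
    by (intro continuous_rt_compose[OF assms(2)] continuous_intros) (auto simp: mult_le_one)
  then have "continuous_on ({0..1} \<times> I) (\<lambda>x. integral (cbox 0 1) (\<lambda>\<theta>. dr f (\<theta> * fst x) (snd x)))"
    by (rule integral_continuous_on_param)
  then show "continuous_on ({0..1} \<times> I) (\<lambda>x. slope f (fst x) (snd x))"
    by (rule continuous_on_eq) (use slope_eq_integral[OF assms(1)] assms(3) in auto)
qed

section \<open>A radial interpolation inequality\<close>

text \<open>The usual argument: the square of \<open>s * f + g\<close> has a nonnegative integral for every \<open>s\<close>.\<close>

lemma Cauchy_Schwarz_integral:
  fixes f g :: "real \<Rightarrow> real"
  assumes "continuous_on {a..b} f" "continuous_on {a..b} g"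
  shows "(integral {a..b} (\<lambda>x. f x * g x))\<^sup>2
    \<le> integral {a..b} (\<lambda>x. (f x)\<^sup>2) * integral {a..b} (\<lambda>x. (g x)\<^sup>2)"
proof -
  let ?A = "integral {a..b} (\<lambda>x. (f x)\<^sup>2)" and ?B = "integral {a..b} (\<lambda>x. f x * g x)"
    and ?C = "integral {a..b} (\<lambda>x. (g x)\<^sup>2)"
  have int: "(\<lambda>x. (f x)\<^sup>2) integrable_on {a..b}" "(\<lambda>x. f x * g x) integrable_on {a..b}"
    "(\<lambda>x. (g x)\<^sup>2) integrable_on {a..b}"
    by (intro integrable_continuous_real continuous_intros assms)+
  have pos: "0 \<le> ?A * s\<^sup>2 + 2 * s * ?B + ?C" for s
  proof -
    have "((\<lambda>x. s\<^sup>2 * (f x)\<^sup>2 + 2 * s * (f x * g x) + (g x)\<^sup>2) has_integral s\<^sup>2 * ?A + 2 * s * ?B + ?C) {a..b}"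
      by (intro has_integral_add has_integral_mult_right) (use int in \<open>simp_all add: has_integral_integral\<close>)
    moreover have "s\<^sup>2 * (f x)\<^sup>2 + 2 * s * (f x * g x) + (g x)\<^sup>2 = (s * f x + g x)\<^sup>2" for x
      by (simp add: power2_eq_square algebra_simps)
    ultimately show ?thesis
      using has_integral_nonneg[of "\<lambda>x. (s * f x + g x)\<^sup>2"] by (simp add: mult.commute)
  qed
  have A: "0 \<le> ?A" by (rule integral_nonneg[OF int(1)]) simp
  show ?thesis
  proof (cases "?A = 0")
    case True
    have "?B = 0"
    proof (rule ccontr)
      assume "?B \<noteq> 0"
      then show False using pos[of "- (?C + 1) / (2 * ?B)"] True by (simp add: field_simps)
    qed
    then show ?thesis using True by simp
  next
    case False
    then have "0 \<le> ?A * (?A * (- ?B / ?A)\<^sup>2 + 2 * (- ?B / ?A) * ?B + ?C)"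
      by (intro mult_nonneg_nonneg[OF A pos])
    also have "\<dots> = ?A * ?C - ?B\<^sup>2"
      using False by (simp add: power2_eq_square field_simps)
    finally show ?thesis by simp
  qed
qed

text \<open>
  Put \<open>L = g' + q\<close>, so that \<open>(r g)' = r L\<close>: for \<open>g = h\<^sub>r\<close> this is the Laplacian of \<open>h\<close>. The number \<open>J\<close>
  is twice the integral of \<open>r \<bar>g L\<bar>\<close>. It bounds \<open>r g\<^sup>2\<close> because \<open>(r g)\<^sup>2\<close> is the integral of
  \<open>2 s g \<cdot> s L\<close> over \<open>[0,r]\<close>, where one factor \<open>s\<close> is at most \<open>r\<close>; it bounds the integral of \<open>g\<^sup>2\<close>
  because \<open>(r g\<^sup>2)' = 2 r g L - g\<^sup>2\<close> and \<open>g 1 = 0\<close>. The last bound is the Cauchy-Schwarz inequality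
  with the weight \<open>r\<close> split evenly. Together they give a bound of Ladyzhenskaya type for the
  integral of \<open>r g\<^sup>4\<close>.
\<close>

lemma radial_interpolation:
  fixes g g' q :: "real \<Rightarrow> real"
  assumes g: "\<And>r. r \<in> {0..1} \<Longrightarrow> (g has_real_derivative g' r) (at r within {0..1})"
    and cont: "continuous_on {0..1} g'" "continuous_on {0..1} q"
    and q: "\<And>r. r \<in> {0..1} \<Longrightarrow> g r = r * q r" and g1: "g 1 = 0"
  obtains J where "J \<ge> 0"
    "\<And>r. r \<in> {0..1} \<Longrightarrow> r * (g r)\<^sup>2 \<le> J"
    "integral {0..1} (\<lambda>r. (g r)\<^sup>2) \<le> J"
    "J\<^sup>2 \<le> 4 * integral {0..1} (\<lambda>r. r * (g r)\<^sup>2) * integral {0..1} (\<lambda>r. r * (g' r + q r)\<^sup>2)"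
proof -
  define L where "L r = g' r + q r" for r
  define J where "J = 2 * integral {0..1} (\<lambda>r. \<bar>r * g r * L r\<bar>)"
  have cg: "continuous_on {0..1} g"
    using g by (intro continuous_on_vector_derivative) (simp add: has_vector_derivative_iff_real)
  have cL: "continuous_on {0..1} L"
    unfolding L_def by (intro continuous_intros cont)
  have iJ: "(\<lambda>r. \<bar>r * g r * L r\<bar>) integrable_on {0..1}"
    by (intro integrable_continuous_real continuous_intros cg cL)
  have J0: "J \<ge> 0"
    unfolding J_def using integral_nonneg[OF iJ] by simp
  have rg: "((\<lambda>r. r * g r) has_real_derivative r * L r) (at r within {0..1})" if "r \<in> {0..1}" for r
    using that q[of r] unfolding L_def
    by (auto intro!: derivative_eq_intros g simp: algebra_simps)
  show ?thesis
  proof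
    show "J \<ge> 0" by (rule J0)
    show "r * (g r)\<^sup>2 \<le> J" if r: "r \<in> {0..1}" for r
    proof (cases "r = 0")
      case False
      have "((\<lambda>s. 2 * (s * g s) * (s * L s)) has_integral (r * g r)\<^sup>2 - (0 * g 0)\<^sup>2) {0..r}"
      proof (rule fundamental_theorem_of_calculus)
        fix s assume s: "s \<in> {0..r}"
        then have "s \<in> {0..1}" using r by auto
        from DERIV_power[OF rg[OF this], of 2]
        have "((\<lambda>s. (s * g s)\<^sup>2) has_real_derivative 2 * (s * g s) * (s * L s)) (at s within {0..1})"
          by (rule DERIV_cong) simp
        then show "((\<lambda>s. (s * g s)\<^sup>2) has_vector_derivative 2 * (s * g s) * (s * L s)) (at s within {0..r})"
          using r by (auto simp: has_vector_derivative_iff_real intro: DERIV_subset)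
      qed (use r in auto)
      moreover have "((\<lambda>s. 2 * r * \<bar>s * g s * L s\<bar>) has_integral 2 * r * integral {0..r} (\<lambda>s. \<bar>s * g s * L s\<bar>)) {0..r}"
        by (intro has_integral_mult_right integrable_integral integrable_on_subinterval[OF iJ]) (use r in auto)
      moreover have "2 * (s * g s) * (s * L s) \<le> 2 * r * \<bar>s * g s * L s\<bar>" if "s \<in> {0..r}" for s
      proof -
        have "2 * (s * g s) * (s * L s) = 2 * s * (s * g s * L s)" by simp
        also have "\<dots> \<le> 2 * s * \<bar>s * g s * L s\<bar>"
          using that by (intro mult_left_mono) auto
        also have "\<dots> \<le> 2 * r * \<bar>s * g s * L s\<bar>"
          using that by (intro mult_right_mono) auto
        finally show ?thesis .
      qed
      ultimately have "(r * g r)\<^sup>2 \<le> 2 * r * integral {0..r} (\<lambda>s. \<bar>s * g s * L s\<bar>)"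
        by (auto dest: has_integral_le)
      also have "\<dots> \<le> r * J"
      proof -
        have "integral {0..r} (\<lambda>s. \<bar>s * g s * L s\<bar>) \<le> integral {0..1} (\<lambda>s. \<bar>s * g s * L s\<bar>)"
          by (intro integral_subset_le iJ integrable_on_subinterval[OF iJ]) (use r in auto)
        then show ?thesis
          unfolding J_def using r mult_left_mono[of _ _ "2 * r"] by fastforce
      qed
      finally have "r * (r * (g r)\<^sup>2) \<le> r * J"
        by (simp add: power2_eq_square mult_ac)
      then show ?thesis using False r by simp
    qed (use J0 in simp)
    have "((\<lambda>r. 2 * (r * g r * L r) - (g r)\<^sup>2) has_integral 1 * (g 1)\<^sup>2 - 0 * (g 0)\<^sup>2) {0..1}"
    proof (rule fundamental_theorem_of_calculus)
      fix r :: real assume r: "r \<in> {0..1}"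
      have "((\<lambda>r. r * (g r)\<^sup>2) has_real_derivative 2 * (r * g r * L r) - (g r)\<^sup>2) (at r within {0..1})"
        using q[OF r] r unfolding L_def
        by (auto intro!: derivative_eq_intros g simp: algebra_simps power2_eq_square)
      then show "((\<lambda>r. r * (g r)\<^sup>2) has_vector_derivative 2 * (r * g r * L r) - (g r)\<^sup>2) (at r within {0..1})"
        by (simp add: has_vector_derivative_iff_real)
    qed simp
    moreover have "(\<lambda>r. r * g r * L r) integrable_on {0..1}" "(\<lambda>r. (g r)\<^sup>2) integrable_on {0..1}"
      by (intro integrable_continuous_real continuous_intros cg cL)+
    ultimately have "integral {0..1} (\<lambda>r. (g r)\<^sup>2) = 2 * integral {0..1} (\<lambda>r. r * g r * L r)"
      using g1 by (simp add: has_integral_iff integral_diff)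
    also have "\<dots> \<le> J"
      unfolding J_def using iJ
      by (intro mult_left_mono integral_le integrable_continuous_real continuous_intros cg cL) auto
    finally show "integral {0..1} (\<lambda>r. (g r)\<^sup>2) \<le> J" .
    have "J\<^sup>2 = 4 * (integral {0..1} (\<lambda>r. (sqrt r * \<bar>g r\<bar>) * (sqrt r * \<bar>L r\<bar>)))\<^sup>2"
    proof -
      have "integral {0..1} (\<lambda>r. (sqrt r * \<bar>g r\<bar>) * (sqrt r * \<bar>L r\<bar>)) = integral {0..1} (\<lambda>r. \<bar>r * g r * L r\<bar>)"
        by (intro integral_cong) (auto simp: abs_mult mult_ac)
      then show ?thesis by (simp add: J_def power2_eq_square)
    qed
    also have "\<dots> \<le> 4 * (integral {0..1} (\<lambda>r. (sqrt r * \<bar>g r\<bar>)\<^sup>2) * integral {0..1} (\<lambda>r. (sqrt r * \<bar>L r\<bar>)\<^sup>2))"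
      by (intro mult_left_mono Cauchy_Schwarz_integral continuous_intros cg cL) simp
    also have "integral {0..1} (\<lambda>r. (sqrt r * \<bar>g r\<bar>)\<^sup>2) = integral {0..1} (\<lambda>r. r * (g r)\<^sup>2)"
      by (intro integral_cong) (auto simp: power_mult_distrib)
    also have "integral {0..1} (\<lambda>r. (sqrt r * \<bar>L r\<bar>)\<^sup>2) = integral {0..1} (\<lambda>r. r * (L r)\<^sup>2)"
      by (intro integral_cong) (auto simp: power_mult_distrib)
    finally show "J\<^sup>2 \<le> 4 * integral {0..1} (\<lambda>r. r * (g r)\<^sup>2) * integral {0..1} (\<lambda>r. r * (g' r + q r)\<^sup>2)"
      by (simp add: L_def)
  qed
qed

section \<open>The equations in terms of the derivatives of \<open>h\<close> and \<open>v\<close>\<close>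

locale viscous_sheet =
  fixes \<sigma> \<mu> T :: real and h0 v0 :: "real \<Rightarrow> real" and h v :: "real \<Rightarrow> real \<Rightarrow> real"
  assumes \<sigma>_pos: "\<sigma> > 0" and \<mu>_pos: "\<mu> > 0" and T_pos: "T > 0"
    and solution: "classical_positive_solution \<sigma> \<mu> T h0 v0 h v"
begin

abbreviation "I \<equiv> {0<..<T}"
abbreviation "h1 \<equiv> dr h"
abbreviation "h2 \<equiv> dr (dr h)"
abbreviation "h3 \<equiv> dr (dr (dr h))"
abbreviation "v1 \<equiv> dr v"
abbreviation "v2 \<equiv> dr (dr v)"

lemma regularity:
  "differentiable_r I h" "differentiable_r I h1" "differentiable_r I h2"
  "continuous_rt I h" "continuous_rt I h1" "continuous_rt I h2" "continuous_rt I h3"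
  "differentiable_r I v" "differentiable_r I v1"
  "continuous_rt I v" "continuous_rt I v1" "continuous_rt I v2"
  "differentiable_t I h" "continuous_rt I (dt h)" "differentiable_t I v" "continuous_rt I (dt v)"
proof -
  have h: "regular_rt 3 I h" and v: "regular_rt 2 I v"
    using solution by (auto simp: classical_positive_solution_def)
  have less: "i < 3 \<Longrightarrow> differentiable_r I ((dr ^^ i) h)" "i \<le> 3 \<Longrightarrow> continuous_rt I ((dr ^^ i) h)"
    "i < 2 \<Longrightarrow> differentiable_r I ((dr ^^ i) v)" "i \<le> 2 \<Longrightarrow> continuous_rt I ((dr ^^ i) v)" for i
    using h v by (simp_all add: regular_rt_def)
  show "differentiable_r I h" "differentiable_r I h1" "differentiable_r I h2"
    using less(1)[of 0] less(1)[of 1] less(1)[of 2] by (simp_all add: numeral_2_eq_2)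
  show "continuous_rt I h" "continuous_rt I h1" "continuous_rt I h2" "continuous_rt I h3"
    using less(2)[of 0] less(2)[of 1] less(2)[of 2] less(2)[of 3]
    by (simp_all add: numeral_2_eq_2 numeral_3_eq_3)
  show "differentiable_r I v" "differentiable_r I v1"
    using less(3)[of 0] less(3)[of 1] by simp_all
  show "continuous_rt I v" "continuous_rt I v1" "continuous_rt I v2"
    using less(4)[of 0] less(4)[of 1] less(4)[of 2] by (simp_all add: numeral_2_eq_2)
  show "differentiable_t I h" "continuous_rt I (dt h)" "differentiable_t I v" "continuous_rt I (dt v)"
    using h v by (simp_all add: regular_rt_def)
qed

lemmas deriv_r = regularity(1,2,3,8,9)[THEN has_real_derivative_dr]
lemmas deriv_t = regularity(13,15)[THEN has_real_derivative_dt]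

lemma boundary:
  assumes "t \<in> I"
  shows "h1 0 t = 0" "h1 1 t = 0" "v 0 t = 0" "v 1 t = 0"
  using solution assms by (simp_all add: classical_positive_solution_def)

lemma interior:
  assumes "r \<in> {0<..<1}" "t \<in> I"
  shows "h r t > 0" "momentum_eq \<sigma> \<mu> h v r t" "mass_eq h v r t"
  using solution assms by (simp_all add: classical_positive_solution_def)

lemma continuous_slopes: "continuous_rt I (slope v)" "continuous_rt I (slope h1)"
  by (rule continuous_rt_slope[OF regularity(8,11) boundary(3)],
      assumption, rule continuous_rt_slope[OF regularity(2,6) boundary(1)])

lemmas cont_rt = regularity(4-7,10-12,14,16)[THEN continuous_rt_compose]
  continuous_slopes[THEN continuous_rt_compose]

lemma deriv_r_interior:
  assumes "t \<in> I" "r \<in> {0<..<1}"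
  shows "((\<lambda>\<rho>. h \<rho> t) has_real_derivative h1 r t) (at r)"
    "((\<lambda>\<rho>. h1 \<rho> t) has_real_derivative h2 r t) (at r)"
    "((\<lambda>\<rho>. h2 \<rho> t) has_real_derivative h3 r t) (at r)"
    "((\<lambda>\<rho>. v \<rho> t) has_real_derivative v1 r t) (at r)"
    "((\<lambda>\<rho>. v1 \<rho> t) has_real_derivative v2 r t) (at r)"
  using deriv_r[OF assms(1), of r] assms(2) by (simp_all add: at_within_interior[of r "{0..1}"])

text \<open>The quotient \<open>(r h v)\<^sub>r / r\<close>, in a form continuous up to \<open>r = 0\<close>.\<close>

definition "mass_flux_div r t = h1 r t * v r t + h r t * v1 r t + h r t * slope v r t"

text \<open>
  The mass equation is assumed in the open interval. With \<open>slope v\<close> in place of \<open>v / r\<close>, both sides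
  are continuous on \<open>[0,1]\<close>, so it extends to the boundary.
\<close>

lemma mass:
  assumes "t \<in> I" "r \<in> {0..1}"
  shows "dt h r t = - mass_flux_div r t"
proof -
  have "dt h r t + mass_flux_div r t = 0"
  proof (rule continuous_constant_on_closure[where S = "{0<..<1::real}" and x = r and
        f = "\<lambda>r. dt h r t + mass_flux_div r t"])
    show "continuous_on (closure {0<..<1}) (\<lambda>r. dt h r t + mass_flux_div r t)"
      unfolding mass_flux_div_def using assms(1)
      by (intro continuous_intros cont_rt) auto
    show "r \<in> closure {0<..<1}" using assms by simp
    fix r :: real assume r: "r \<in> {0<..<1}"
    have "dr (\<lambda>r t. r * h r t * v r t) r t = h r t * v r t + r * h1 r t * v r t + r * h r t * v1 r t"
      using assms(1) r by (intro dr_eqI) (auto intro!: derivative_eq_intros deriv_r simp: algebra_simps)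
    then have "dt h r t = - (h r t * v r t + r * h1 r t * v r t + r * h r t * v1 r t) / r"
      using interior(3)[OF r assms(1)] by (simp add: mass_eq_def)
    moreover have "h r t * slope v r t = h r t * v r t / r" "r \<noteq> 0"
      using r by (simp_all add: slope_def)
    ultimately show "dt h r t + mass_flux_div r t = 0"
      by (simp add: mass_flux_div_def add_divide_distrib diff_divide_distrib)
  qed
  then show ?thesis by simp
qed

lemma dr_r_h1: "t \<in> I \<Longrightarrow> r \<in> {0..1} \<Longrightarrow> dr (\<lambda>r t. r * h1 r t) r t = h1 r t + r * h2 r t"
  by (intro dr_eqI) (auto intro!: derivative_eq_intros deriv_r simp: algebra_simps)

lemma dr_r_v: "t \<in> I \<Longrightarrow> r \<in> {0..1} \<Longrightarrow> dr (\<lambda>r t. r * v r t) r t = v r t + r * v1 r t"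
  by (intro dr_eqI) (auto intro!: derivative_eq_intros deriv_r simp: algebra_simps)

lemma dr_v_r: "t \<in> I \<Longrightarrow> r \<in> {0..1} \<Longrightarrow> dr (\<lambda>r t. v r t * r) r t = v r t + r * v1 r t"
  using dr_r_v by (simp add: mult.commute)

lemma momentum:
  assumes t: "t \<in> I" and r: "r \<in> {0<..<1}"
  shows "dt v r t = - v r t * v1 r t + \<sigma> * (h3 r t + h2 r t / r - h1 r t / r\<^sup>2)
    + 4 * \<mu> / h r t * (h1 r t / r * (v r t + r * v1 r t) - h r t / r\<^sup>2 * (v r t + r * v1 r t)
       + h r t / r * (2 * v1 r t + r * v2 r t) - v r t * h1 r t / (2 * r))"
proof -
  have r': "r \<in> {0..1}" "r \<noteq> 0" using r by auto
  have "((\<lambda>\<rho>. 1 / \<rho> * (h1 \<rho> t + \<rho> * h2 \<rho> t)) has_real_derivative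
      h3 r t + h2 r t / r - h1 r t / r\<^sup>2) (at r within {0..1})"
    using t r' by (auto intro!: derivative_eq_intros deriv_r simp: field_simps power2_eq_square)
  then have "((\<lambda>\<rho>. 1 / \<rho> * dr (\<lambda>r t. r * h1 r t) \<rho> t) has_real_derivative
      h3 r t + h2 r t / r - h1 r t / r\<^sup>2) (at r within {0..1})"
    by (rule has_field_derivative_transform_within[OF _ zero_less_one r'(1)]) (simp add: dr_r_h1[OF t])
  then have 1: "dr (\<lambda>r t. 1 / r * dr (\<lambda>r t. r * h1 r t) r t) r t = h3 r t + h2 r t / r - h1 r t / r\<^sup>2"
    by (rule dr_eqI[OF r'(1)])
  have "((\<lambda>\<rho>. h \<rho> t / \<rho> * (v \<rho> t + \<rho> * v1 \<rho> t)) has_real_derivative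
      h1 r t / r * (v r t + r * v1 r t) - h r t / r\<^sup>2 * (v r t + r * v1 r t)
       + h r t / r * (2 * v1 r t + r * v2 r t)) (at r within {0..1})"
    using t r' by (auto intro!: derivative_eq_intros deriv_r simp: field_simps power2_eq_square)
  then have "((\<lambda>\<rho>. h \<rho> t / \<rho> * dr (\<lambda>r t. r * v r t) \<rho> t) has_real_derivative
      h1 r t / r * (v r t + r * v1 r t) - h r t / r\<^sup>2 * (v r t + r * v1 r t)
       + h r t / r * (2 * v1 r t + r * v2 r t)) (at r within {0..1})"
    by (rule has_field_derivative_transform_within[OF _ zero_less_one r'(1)]) (simp add: dr_r_v[OF t])
  then have 2: "dr (\<lambda>r t. h r t / r * dr (\<lambda>r t. r * v r t) r t) r t =
      h1 r t / r * (v r t + r * v1 r t) - h r t / r\<^sup>2 * (v r t + r * v1 r t)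
       + h r t / r * (2 * v1 r t + r * v2 r t)"
    by (rule dr_eqI[OF r'(1)])
  show ?thesis
    using interior(2)[OF r t] unfolding momentum_eq_def 1 2 by (simp add: algebra_simps)
qed

text \<open>
  This is \<open>r h\<^sub>r\<^sub>t\<close> as the mass equation predicts it: \<open>- r\<close> times the \<open>r\<close>-derivative of
  \<open>w\<^sub>r + w / r\<close> with \<open>w = h v\<close>. The factor \<open>r\<close> is kept because \<open>w / r\<close> is continuous up to the
  centre by \<open>continuous_rt_slope\<close>, while its radial derivative would need a second-order argument there.
\<close>

definition "r_h1_t r t = h r t * slope v r t - (h1 r t * v r t + h r t * v1 r t)
  - r * (h2 r t * v r t + 2 * h1 r t * v1 r t + h r t * v2 r t)"

lemma r_h1_t_0: "t \<in> I \<Longrightarrow> r_h1_t 0 t = 0"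
  using boundary[of t] by (simp add: r_h1_t_def slope_def)

text \<open>
  Differentiability of \<open>h\<^sub>r\<close> in time is not given. The increment of \<open>h\<close>, however, is the time integral
  of \<open>- (r h v)\<^sub>r / r\<close>, which can be differentiated in \<open>r\<close> under the integral sign.
\<close>

lemma h1_increment:
  assumes ab: "{a..b} \<subseteq> I" "a \<le> b" and r: "r \<in> {0<..1}"
  shows "h1 r b - h1 r a = integral {a..b} (\<lambda>s. r_h1_t r s / r)"
proof -
  have inc: "h \<rho> b - h \<rho> a = integral {a..b} (\<lambda>s. - mass_flux_div \<rho> s)" if \<rho>: "\<rho> \<in> {0..1}" for \<rho>
  proof -
    have "((\<lambda>s. - mass_flux_div \<rho> s) has_integral h \<rho> b - h \<rho> a) {a..b}"
    proof (rule fundamental_theorem_of_calculus[OF ab(2)])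
      fix s assume "s \<in> {a..b}"
      then have s: "s \<in> I" using ab by auto
      show "(h \<rho> has_vector_derivative - mass_flux_div \<rho> s) (at s within {a..b})"
        using deriv_t(1)[OF s \<rho>] mass[OF s \<rho>] by (simp add: has_vector_derivative_iff_real has_field_derivative_at_within)
    qed
    then show ?thesis using integral_unique by metis
  qed
  have "((\<lambda>\<rho>. integral (cbox a b) (\<lambda>s. - mass_flux_div \<rho> s)) has_real_derivative
      integral (cbox a b) (\<lambda>s. r_h1_t r s / r)) (at r within {0<..1})"
  proof (rule leibniz_rule_field_derivative)
    fix \<rho> s :: real assume \<rho>: "\<rho> \<in> {0<..1}" and "s \<in> cbox a b"
    then have s: "s \<in> I" using ab by auto
    note deriv = deriv_r[OF s, THEN DERIV_subset, of _ "{0<..1}"]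
    have "((\<lambda>\<rho>. - (h1 \<rho> s * v \<rho> s + h \<rho> s * v1 \<rho> s + h \<rho> s * (v \<rho> s / \<rho>))) has_real_derivative
      r_h1_t \<rho> s / \<rho>) (at \<rho> within {0<..1})"
      using \<rho> by (auto intro!: derivative_eq_intros deriv simp: r_h1_t_def slope_def field_simps)
    then show "((\<lambda>\<rho>. - mass_flux_div \<rho> s) has_real_derivative r_h1_t \<rho> s / \<rho>) (at \<rho> within {0<..1})"
      by (rule has_field_derivative_transform_within[OF _ zero_less_one \<rho>])
        (simp add: mass_flux_div_def slope_def)
  next
    fix \<rho> :: real assume "\<rho> \<in> {0<..1}"
    then show "(\<lambda>s. - mass_flux_div \<rho> s) integrable_on cbox a b"
      unfolding mass_flux_div_def using ab
      by (intro integrable_continuous continuous_intros cont_rt) auto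
  next
    show "continuous_on ({0<..1} \<times> cbox a b) (\<lambda>(\<rho>, s). r_h1_t \<rho> s / \<rho>)"
      unfolding r_h1_t_def case_prod_beta' using ab
      by (intro continuous_intros cont_rt) auto
  qed (use r in auto)
  then have D1: "((\<lambda>\<rho>. h \<rho> b - h \<rho> a) has_real_derivative
      integral (cbox a b) (\<lambda>s. r_h1_t r s / r)) (at r within {0<..1})"
    by (rule has_field_derivative_transform_within[OF _ zero_less_one r]) (simp add: inc)
  have D2: "((\<lambda>\<rho>. h \<rho> b - h \<rho> a) has_real_derivative h1 r b - h1 r a) (at r within {0<..1})"
    using ab r by (intro DERIV_diff DERIV_subset[OF deriv_r(1)]) auto
  have "at r within {0<..1} \<noteq> bot"
    using r by (simp add: trivial_limit_within)
  from vector_derivative_unique_within[OF this D2[folded has_vector_derivative_iff_real] D1[folded has_vector_derivative_iff_real]]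
  show ?thesis by simp
qed

lemma deriv_t_h1:
  assumes t: "t \<in> I" and r: "r \<in> {0<..1}"
  shows "((\<lambda>s. h1 r s) has_real_derivative r_h1_t r t / r) (at t)"
proof -
  define a b where "a = t / 2" and "b = (t + T) / 2"
  have ab: "a < t" "t < b" "{a..b} \<subseteq> I"
    using t by (auto simp: a_def b_def)
  have "continuous_on {a..b} (\<lambda>s. r_h1_t r s / r)"
    unfolding r_h1_t_def using ab r by (intro continuous_intros cont_rt) auto
  then have "((\<lambda>x. integral {a..x} (\<lambda>s. r_h1_t r s / r)) has_real_derivative r_h1_t r t / r) (at t within {a..b})"
    by (rule integral_has_real_derivative) (use ab in auto)
  then have "((\<lambda>x. h1 r a + integral {a..x} (\<lambda>s. r_h1_t r s / r)) has_real_derivative r_h1_t r t / r) (at t within {a..b})"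
    using DERIV_add[OF DERIV_const, of _ "r_h1_t r t / r" t "{a..b}" "h1 r a"] by simp
  then have "((\<lambda>x. h1 r x) has_real_derivative r_h1_t r t / r) (at t within {a..b})"
  proof (rule has_field_derivative_transform_within[OF _ zero_less_one])
    fix x assume "x \<in> {a..b}"
    then have "{a..x} \<subseteq> I" "a \<le> x"
      using ab(3) by auto
    from h1_increment[OF this r] show "h1 r a + integral {a..x} (\<lambda>s. r_h1_t r s / r) = h1 r x"
      by linarith
  qed (use ab in auto)
  then show ?thesis
    using at_within_Icc_at[OF ab(1,2)] by simp
qed

section \<open>The energy inequality\<close>

text \<open>The time derivative of the energy density, with \<open>r h\<^sub>r\<^sub>t\<close> expressed by \<open>r_h1_t\<close>.\<close>

definition "energy_rate t r = r * dt h r t * (v r t)\<^sup>2 / 2 + r * h r t * v r t * dt v r t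
  + \<sigma> * h1 r t * r_h1_t r t"

text \<open>
  The terms are, in this order, the transport of kinetic energy, the work of the capillary force
  \<open>\<sigma> r h v (D / r)\<close>, the term \<open>\<sigma> r h\<^sub>r h\<^sub>t\<close> from integrating \<open>\<sigma> r h\<^sub>r h\<^sub>r\<^sub>t\<close> by parts, and the two
  viscous boundary terms. Every division by \<open>r\<close> has been cancelled, the one in \<open>h\<^sub>t\<close> by the mass
  equation, so that continuity and the boundary values are evident.
\<close>

definition "energy_flux t r = - r * h r t * v r t ^ 3 / 2
  + \<sigma> * (h r t * v r t * (h1 r t + r * h2 r t))
  - \<sigma> * (h1 r t * (r * h1 r t * v r t + r * h r t * v1 r t + h r t * v r t))
  + 4 * \<mu> * (v r t * h r t * (v r t + r * v1 r t)) - 2 * \<mu> * ((v r t)\<^sup>2 * h r t)"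

lemma deriv_t_energy_density:
  assumes t: "t \<in> I" and r: "r \<in> {0..1}"
  shows "((\<lambda>s. energy_density \<sigma> h v s r) has_real_derivative energy_rate t r) (at t)"
proof (cases "r = 0")
  case True
  then show ?thesis
    using boundary[OF t] by (simp add: energy_density_def energy_rate_def)
next
  case False
  then have "r \<in> {0<..1}" using r by auto
  show ?thesis
    unfolding energy_density_def energy_rate_def power2_abs
    apply (rule derivative_eq_intros deriv_t[OF t r] deriv_t_h1[OF t \<open>r \<in> {0<..1}\<close>]
        numeral_neq_zero refl)+
    using False by (simp add: field_simps power2_eq_square)
qed

lemma continuous_energy_density:
  "t \<in> I \<Longrightarrow> continuous_on {0..1} (energy_density \<sigma> h v t)"
  unfolding energy_density_def[abs_def] by (intro continuous_intros cont_rt) auto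

lemma continuous_energy_rate:
  "continuous_on (I \<times> {0..1}) (\<lambda>x. energy_rate (fst x) (snd x))"
  unfolding energy_rate_def r_h1_t_def by (intro continuous_intros cont_rt) auto

lemma deriv_energy:
  "t \<in> I \<Longrightarrow> ((\<lambda>s. integral {0..1} (energy_density \<sigma> h v s)) has_real_derivative
      integral {0..1} (energy_rate t)) (at t)"
  by (rule has_real_derivative_integral[OF deriv_t_energy_density
      continuous_energy_density continuous_energy_rate])

text \<open>
  The capillary terms cancel by the mass equation, \<open>r h\<^sub>t = - (r h v)\<^sub>r\<close>, and the convective terms form
  a derivative for the same reason. The viscous terms are rewritten by the expansion of
  \<open>(v + r v\<^sub>r)\<^sup>2\<close>.
\<close>

lemma energy_flux_deriv:
  assumes t: "t \<in> I" and r: "r \<in> {0<..<1}"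
  shows "(energy_flux t has_real_derivative energy_rate t r
      + 2 * \<mu> * (h r t * (v r t + r * v1 r t)\<^sup>2 / r)
      + 2 * \<mu> * (h r t * ((v r t)\<^sup>2 / r + r * (v1 r t)\<^sup>2))) (at r)"
proof -
  have nz: "r \<noteq> 0" "h r t \<noteq> 0"
    using r interior(1)[OF r t] by auto
  have q: "v r t = r * (v r t / r)" and p: "h1 r t = r * (h1 r t / r)"
    using nz by simp_all
  \<comment> \<open>Dividing \<open>v\<close> and \<open>h\<^sub>r\<close> by \<open>r\<close> turns the claim into an identity with few denominators.\<close>
  obtain q p where q: "v r t = r * q" and p: "h1 r t = r * p"
    using q p by blast
  have ht: "dt h r t = - (h1 r t * v r t + h r t * v1 r t + h r t * (v r t / r))"
    using mass[OF t, of r] r by (simp add: mass_flux_div_def slope_def)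
  have N: "r_h1_t r t = h r t * (v r t / r) - (h1 r t * v r t + h r t * v1 r t)
    - r * (h2 r t * v r t + 2 * h1 r t * v1 r t + h r t * v2 r t)"
    using r by (simp add: r_h1_t_def slope_def)
  show ?thesis
    unfolding energy_flux_def[abs_def] energy_rate_def ht N momentum[OF t r]
    apply (rule derivative_eq_intros deriv_r_interior[OF t r] numeral_neq_zero refl)+
    using nz by (simp add: q p power2_eq_square power3_eq_cube) (simp add: field_simps)
qed

lemma energy_flux_boundary: "t \<in> I \<Longrightarrow> energy_flux t 0 = 0" "t \<in> I \<Longrightarrow> energy_flux t 1 = 0"
  using boundary[of t] by (simp_all add: energy_flux_def)

lemma continuous_energy_flux: "t \<in> I \<Longrightarrow> continuous_on {0..1} (energy_flux t)"
  unfolding energy_flux_def[abs_def] by (intro continuous_intros cont_rt) auto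

text \<open>
  At \<open>r = 0\<close> both sides vanish: on the left because division by zero yields zero, on the right
  through the factor \<open>v\<close>, \<open>h\<^sub>r\<close> or \<open>r\<close>. So the singular integrands agree with continuous functions on all of \<open>[0,1]\<close>.
\<close>

lemma quotient_eq_slope:
  assumes t: "t \<in> I"
  shows "v r t * (v r t / r) = v r t * slope v r t" "h1 r t * (h1 r t / r) = h1 r t * slope h1 r t"
    "(h1 r t + r * h2 r t)\<^sup>2 / r = r * (h2 r t + slope h1 r t)\<^sup>2"
    "(v r t + r * v1 r t)\<^sup>2 / r = r * (slope v r t + v1 r t)\<^sup>2"
proof -
  show "v r t * (v r t / r) = v r t * slope v r t" "h1 r t * (h1 r t / r) = h1 r t * slope h1 r t"
    using boundary[OF t] by (auto simp: slope_def)
  have "h1 r t = r * slope h1 r t" "v r t = r * slope v r t"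
    using boundary[OF t] by (simp_all add: mult_slope)
  then have "(h1 r t + r * h2 r t)\<^sup>2 = r * (r * (h2 r t + slope h1 r t)\<^sup>2)"
    "(v r t + r * v1 r t)\<^sup>2 = r * (r * (slope v r t + v1 r t)\<^sup>2)"
    by (metis add.commute distrib_left mult.assoc power2_eq_square power_mult_distrib)+
  then show "(h1 r t + r * h2 r t)\<^sup>2 / r = r * (h2 r t + slope h1 r t)\<^sup>2"
    "(v r t + r * v1 r t)\<^sup>2 / r = r * (slope v r t + v1 r t)\<^sup>2"
    by (cases "r = 0"; simp)+
qed

lemma dissipation_eq:
  assumes t: "t \<in> I" and r: "r \<in> {0..1}"
  shows "viscous_dissipation h v t r = h r t * (r * (slope v r t + v1 r t)\<^sup>2)"
    and "remainder_density h v t r = h r t * (v r t * slope v r t)"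
    and "h r t * ((v r t)\<^sup>2 / r + r * (v1 r t)\<^sup>2) = h r t * (v r t * slope v r t + r * (v1 r t)\<^sup>2)"
    and "capillary_dissipation h t r = r * (h2 r t + slope h1 r t)\<^sup>2"
  unfolding viscous_dissipation_def remainder_density_def capillary_dissipation_def power2_abs
    dr_v_r[OF t r] dr_r_h1[OF t r] times_divide_eq_right[symmetric] quotient_eq_slope[OF t, symmetric]
  by (simp_all add: power2_eq_square)

lemma integrable_energy_terms:
  assumes t: "t \<in> I"
  shows "energy_density \<sigma> h v t integrable_on {0..1}"
    "viscous_dissipation h v t integrable_on {0..1}"
    "remainder_density h v t integrable_on {0..1}"
    "capillary_dissipation h t integrable_on {0..1}"
    "(\<lambda>r. h r t * ((v r t)\<^sup>2 / r + r * (v1 r t)\<^sup>2)) integrable_on {0..1}"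
    "energy_rate t integrable_on {0..1}"
proof -
  have "(\<lambda>r. h r t * (r * (slope v r t + v1 r t)\<^sup>2)) integrable_on {0..1}"
    "(\<lambda>r. h r t * (v r t * slope v r t)) integrable_on {0..1}"
    "(\<lambda>r. h r t * (v r t * slope v r t + r * (v1 r t)\<^sup>2)) integrable_on {0..1}"
    "(\<lambda>r. r * (h2 r t + slope h1 r t)\<^sup>2) integrable_on {0..1}"
    using t by (intro integrable_continuous_real continuous_intros cont_rt; auto)+
  note int = this[THEN integrable_eq]
  show "viscous_dissipation h v t integrable_on {0..1}"
    "remainder_density h v t integrable_on {0..1}"
    "capillary_dissipation h t integrable_on {0..1}"
    "(\<lambda>r. h r t * ((v r t)\<^sup>2 / r + r * (v1 r t)\<^sup>2)) integrable_on {0..1}"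
    by (rule int(1)[OF dissipation_eq(1)[OF t, symmetric]] int(2)[OF dissipation_eq(2)[OF t, symmetric]]
        int(3)[OF dissipation_eq(3)[OF t, symmetric]] int(4)[OF dissipation_eq(4)[OF t, symmetric]];
        assumption)+
  show "energy_density \<sigma> h v t integrable_on {0..1}"
    by (intro integrable_continuous_real continuous_energy_density t)
  have "continuous_on {0..1} (energy_rate t)"
    unfolding energy_rate_def[abs_def] r_h1_t_def using t
    by (intro continuous_intros cont_rt) auto
  then show "energy_rate t integrable_on {0..1}"
    by (rule integrable_continuous_real)
qed

lemma h_nonneg:
  assumes t: "t \<in> I" and r: "r \<in> {0..1}"
  shows "h r t \<ge> 0"
proof (rule continuous_ge_on_closure[where S = "{0<..<1::real}" and x = r and f = "\<lambda>r. h r t"])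
  show "continuous_on (closure {0<..<1}) (\<lambda>r. h r t)"
    using t by (intro continuous_intros cont_rt) auto
  show "\<And>x. x \<in> {0<..<1} \<Longrightarrow> 0 \<le> h x t"
    using interior(1)[OF _ t] by (simp add: less_imp_le)
qed (use r in simp)

lemma energy_balance:
  assumes t: "t \<in> I"
  shows "integral {0..1} (energy_rate t) = - 2 * \<mu> * integral {0..1} (viscous_dissipation h v t)
    - 2 * \<mu> * integral {0..1} (\<lambda>r. h r t * ((v r t)\<^sup>2 / r + r * (v1 r t)\<^sup>2))"
proof -
  let ?F = "\<lambda>r. energy_rate t r + 2 * \<mu> * viscous_dissipation h v t r
      + 2 * \<mu> * (h r t * ((v r t)\<^sup>2 / r + r * (v1 r t)\<^sup>2))"
  have "(?F has_integral energy_flux t 1 - energy_flux t 0) {0..1}"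
  proof (rule fundamental_theorem_of_calculus_interior)
    fix r :: real assume r: "r \<in> {0<..<1}"
    then show "(energy_flux t has_vector_derivative ?F r) (at r)"
      using energy_flux_deriv[OF t r] dr_v_r[OF t, of r]
      by (simp add: has_vector_derivative_iff_real viscous_dissipation_def)
  qed (use continuous_energy_flux[OF t] in auto)
  then have "integral {0..1} ?F = 0"
    by (simp add: energy_flux_boundary[OF t] integral_unique)
  moreover have "integral {0..1} ?F = integral {0..1} (energy_rate t)
    + 2 * \<mu> * integral {0..1} (viscous_dissipation h v t)
    + 2 * \<mu> * integral {0..1} (\<lambda>r. h r t * ((v r t)\<^sup>2 / r + r * (v1 r t)\<^sup>2))"
    by (intro integral_unique has_integral_add has_integral_mult_right integrable_integral
        integrable_energy_terms t)
  ultimately show ?thesis by simp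
qed

lemma energy_rate_le:
  assumes t: "t \<in> I"
  shows "integral {0..1} (energy_rate t) \<le> - 2 * \<mu> * integral {0..1} (viscous_dissipation h v t)"
proof -
  have "0 \<le> integral {0..1} (\<lambda>r. h r t * ((v r t)\<^sup>2 / r + r * (v1 r t)\<^sup>2))"
    using h_nonneg[OF t] by (intro integral_nonneg integrable_energy_terms t) auto
  then show ?thesis
    using \<mu>_pos by (simp add: energy_balance[OF t])
qed

lemma viscous_dissipation_nonneg:
  "t \<in> I \<Longrightarrow> 0 \<le> integral {0..1} (viscous_dissipation h v t)"
  using h_nonneg by (intro integral_nonneg integrable_energy_terms) (auto simp: viscous_dissipation_def)

text \<open>
  The energy inequality holds for positive times only. Continuity of \<open>h\<close>, \<open>h\<^sub>r\<close> and \<open>v\<close> down to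
  \<open>t = 0\<close> extends the bound to the initial energy, which depends on \<open>h\<^sub>0\<close> and \<open>v\<^sub>0\<close> alone.
\<close>

lemma energy_le_initial:
  assumes t: "t \<in> I"
  shows "integral {0..1} (energy_density \<sigma> h v t)
    \<le> integral {0..1} (energy_density \<sigma> (\<lambda>r t. h0 r) (\<lambda>r t. v0 r) 0)"
proof -
  have cont: "continuous_rt {0..<T} h" "continuous_rt {0..<T} h1" "continuous_rt {0..<T} v"
    and diff: "differentiable_r {0..<T} h"
    and init: "\<And>r. r \<in> {0..1} \<Longrightarrow> h r 0 = h0 r \<and> v r 0 = v0 r"
    using solution by (auto simp: classical_positive_solution_def)
  have "continuous_on ({0..<T} \<times> cbox 0 1) (\<lambda>(s, r). energy_density \<sigma> h v s r)"
    unfolding energy_density_def case_prod_beta'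
    by (intro continuous_intros cont[THEN continuous_rt_compose]) auto
  then have "continuous_on {0..<T} (\<lambda>s. integral (cbox 0 1) (energy_density \<sigma> h v s))"
    by (rule integral_continuous_on_param)
  then have cE: "continuous_on {0..t} (\<lambda>s. integral {0..1} (energy_density \<sigma> h v s))"
    using t by (auto intro: continuous_on_subset)
  have "integral {0..1} (energy_density \<sigma> h v t) \<le> integral {0..1} (energy_density \<sigma> h v 0)"
  proof (rule DERIV_nonpos_imp_decreasing_open[OF _ _ cE])
    fix s assume "0 < s" "s < t"
    then have s: "s \<in> I" using t by auto
    have "integral {0..1} (energy_rate s) \<le> 0"
      using energy_rate_le[OF s] mult_nonneg_nonneg[OF _ viscous_dissipation_nonneg[OF s], of "2 * \<mu>"] \<mu>_pos
      by simp
    then show "\<exists>y. ((\<lambda>s. integral {0..1} (energy_density \<sigma> h v s)) has_real_derivative y) (at s) \<and> y \<le> 0"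
      using deriv_energy[OF s] by blast
  qed (use t in simp)
  also have "integral {0..1} (energy_density \<sigma> h v 0)
    = integral {0..1} (energy_density \<sigma> (\<lambda>r t. h0 r) (\<lambda>r t. v0 r) 0)"
  proof (rule integral_cong)
    fix r :: real assume r: "r \<in> {0..1}"
    have "((\<lambda>\<rho>. h \<rho> 0) has_real_derivative h1 r 0) (at r within {0..1})"
      using T_pos r by (intro has_real_derivative_dr[OF diff]) auto
    then have "((\<lambda>\<rho>. h0 \<rho>) has_real_derivative h1 r 0) (at r within {0..1})"
      by (rule has_field_derivative_transform_within[OF _ zero_less_one r]) (simp add: init)
    then have "dr (\<lambda>r t. h0 r) r 0 = h1 r 0"
      by (rule dr_eqI[OF r])
    then show "energy_density \<sigma> h v 0 r = energy_density \<sigma> (\<lambda>r t. h0 r) (\<lambda>r t. v0 r) 0 r"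
      using init[OF r] by (simp add: energy_density_def)
  qed
  finally show ?thesis .
qed

section \<open>The entropy balance\<close>

text \<open>
  Expanding the square in the entropy density gives the energy density plus
  \<open>4 \<mu> v r h\<^sub>r + 8 \<mu>\<^sup>2 r h\<^sub>r\<^sup>2 / h\<close>; this is the time derivative of that sum.
\<close>

definition "entropy_rate t r = energy_rate t r + 4 * \<mu> * (dt v r t * (r * h1 r t))
  + 4 * \<mu> * (v r t * r_h1_t r t) + 16 * \<mu>\<^sup>2 * (h1 r t * r_h1_t r t / h r t)
  - 8 * \<mu>\<^sup>2 * (r * (h1 r t)\<^sup>2 * dt h r t / (h r t)\<^sup>2)"

text \<open>
  Compared with the energy, the transported quantity is \<open>h u\<^sup>2 / 2\<close>, the viscous terms are absorbed in
  \<open>u = v + 4 \<mu> h\<^sub>r / h\<close>, and \<open>4 \<mu> \<sigma> h\<^sub>r D\<close> is the boundary term that turns \<open>r h\<^sub>r (D / r)\<^sub>r\<close> into the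
  dissipation \<open>- D\<^sup>2 / r\<close>.
\<close>

definition "entropy_flux t r = - (r * v r t * h r t * (v r t + 4 * \<mu> * (h1 r t / h r t))\<^sup>2) / 2
  + \<sigma> * (h r t * v r t * (h1 r t + r * h2 r t))
  - \<sigma> * (h1 r t * (r * h1 r t * v r t + r * h r t * v1 r t + h r t * v r t))
  + 4 * \<mu> * \<sigma> * (h1 r t * (h1 r t + r * h2 r t))"

text \<open>
  Equivalent to testing \<open>h (u\<^sub>t + v u\<^sub>r) = \<sigma> h (D / r)\<^sub>r + 2 \<mu> h\<^sub>r v / r\<close> with \<open>r u\<close>. The last summand is
  what the coefficient \<open>1 / 2\<close> of \<open>v h\<^sub>r / r\<close> in the momentum equation leaves over; it produces the
  source, which has no sign.
\<close>

lemma entropy_flux_deriv: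
  assumes t: "t \<in> I" and r: "r \<in> {0<..<1}"
  shows "(entropy_flux t has_real_derivative entropy_rate t r
      + 4 * \<mu> * \<sigma> * ((h1 r t + r * h2 r t)\<^sup>2 / r)
      - (2 * \<mu> * (h1 r t * (v r t)\<^sup>2) + 8 * \<mu>\<^sup>2 * (v r t * (h1 r t)\<^sup>2 / h r t))) (at r)"
proof -
  have nz: "r \<noteq> 0" "h r t \<noteq> 0"
    using r interior(1)[OF r t] by auto
  have q: "v r t = r * (v r t / r)" and p: "h1 r t = r * h r t * (h1 r t / (r * h r t))"
    using nz by simp_all
  \<comment> \<open>The factor \<open>h\<close> in \<open>h\<^sub>r = r h p\<close> also clears the quotients \<open>h\<^sub>r / h\<close>.\<close>
  obtain q p where q: "v r t = r * q" and p: "h1 r t = r * h r t * p"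
    using q p by blast
  have ht: "dt h r t = - (h1 r t * v r t + h r t * v1 r t + h r t * (v r t / r))"
    using mass[OF t, of r] r by (simp add: mass_flux_div_def slope_def)
  have N: "r_h1_t r t = h r t * (v r t / r) - (h1 r t * v r t + h r t * v1 r t)
    - r * (h2 r t * v r t + 2 * h1 r t * v1 r t + h r t * v2 r t)"
    using r by (simp add: r_h1_t_def slope_def)
  show ?thesis
    unfolding entropy_flux_def[abs_def] entropy_rate_def energy_rate_def ht N momentum[OF t r]
    apply (rule derivative_eq_intros deriv_r_interior[OF t r] numeral_neq_zero nz refl)+
    using nz by (simp add: q p power2_eq_square power3_eq_cube) (simp add: field_simps)
qed

lemma entropy_flux_boundary: "t \<in> I \<Longrightarrow> entropy_flux t 0 = 0" "t \<in> I \<Longrightarrow> entropy_flux t 1 = 0"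
  using boundary[of t] by (simp_all add: entropy_flux_def)

end

text \<open>The entropy contains \<open>1 / h\<close>, so it requires a lower bound for \<open>h\<close>.\<close>

locale thick_sheet = viscous_sheet +
  fixes m :: real
  assumes m_pos: "m > 0"
    and h_ge_interior: "\<And>r t. r \<in> {0<..<1} \<Longrightarrow> t \<in> {0..<T} \<Longrightarrow> h r t \<ge> m"
begin

lemma h_ge:
  assumes t: "t \<in> I" and r: "r \<in> {0..1}"
  shows "h r t \<ge> m"
proof (rule continuous_ge_on_closure[where S = "{0<..<1::real}" and x = r and f = "\<lambda>r. h r t"])
  show "continuous_on (closure {0<..<1}) (\<lambda>r. h r t)"
    using t by (intro continuous_intros cont_rt) auto
  show "\<And>x. x \<in> {0<..<1} \<Longrightarrow> m \<le> h x t"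
    using h_ge_interior t by simp
qed (use r in simp)

lemma h_neq_0: "t \<in> I \<Longrightarrow> r \<in> {0..1} \<Longrightarrow> h r t \<noteq> 0"
  using h_ge[of t r] m_pos by auto

lemma deriv_t_entropy_density:
  assumes t: "t \<in> I" and r: "r \<in> {0..1}"
  shows "((\<lambda>s. entropy_density \<sigma> \<mu> h v s r) has_real_derivative entropy_rate t r) (at t)"
proof (cases "r = 0")
  case True
  then show ?thesis
    using boundary[OF t]
    by (simp add: entropy_density_def entropy_rate_def energy_rate_def r_h1_t_0[OF t])
next
  case False
  then have "r \<in> {0<..1}" using r by auto
  show ?thesis
    unfolding entropy_density_def entropy_rate_def energy_rate_def power2_abs
    apply (rule derivative_eq_intros deriv_t[OF t r] deriv_t_h1[OF t \<open>r \<in> {0<..1}\<close>]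
        numeral_neq_zero h_neq_0[OF t r] refl)+
    using False h_neq_0[OF t r] by (simp add: field_simps power2_eq_square)
qed

lemma continuous_entropy_density:
  "t \<in> I \<Longrightarrow> continuous_on {0..1} (entropy_density \<sigma> \<mu> h v t)"
  unfolding entropy_density_def[abs_def]
  by (intro continuous_intros cont_rt) (auto simp: h_neq_0)

lemma continuous_entropy_rate:
  "continuous_on (I \<times> {0..1}) (\<lambda>x. entropy_rate (fst x) (snd x))"
  unfolding entropy_rate_def energy_rate_def r_h1_t_def
  by (intro continuous_intros cont_rt) (auto simp: h_neq_0)

lemma deriv_entropy:
  "t \<in> I \<Longrightarrow> ((\<lambda>s. integral {0..1} (entropy_density \<sigma> \<mu> h v s)) has_real_derivative
      integral {0..1} (entropy_rate t)) (at t)"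
  by (rule has_real_derivative_integral[OF deriv_t_entropy_density
      continuous_entropy_density continuous_entropy_rate])

lemma continuous_entropy_flux: "t \<in> I \<Longrightarrow> continuous_on {0..1} (entropy_flux t)"
  unfolding entropy_flux_def[abs_def] by (intro continuous_intros cont_rt) (auto simp: h_neq_0)

abbreviation "source t r \<equiv>
  2 * \<mu> * (h1 r t * (v r t)\<^sup>2) + 8 * \<mu>\<^sup>2 * (v r t * (h1 r t)\<^sup>2 / h r t)"

lemma integrable_entropy_terms:
  assumes t: "t \<in> I"
  shows "entropy_density \<sigma> \<mu> h v t integrable_on {0..1}"
    "entropy_rate t integrable_on {0..1}" "source t integrable_on {0..1}"
proof -
  show "entropy_density \<sigma> \<mu> h v t integrable_on {0..1}"
    by (intro integrable_continuous_real continuous_entropy_density t)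
  have "continuous_on {0..1} (entropy_rate t)" "continuous_on {0..1} (source t)"
    unfolding entropy_rate_def[abs_def] energy_rate_def r_h1_t_def using t
    by (intro continuous_intros cont_rt; auto simp: h_neq_0)+
  then show "entropy_rate t integrable_on {0..1}" "source t integrable_on {0..1}"
    by (auto intro: integrable_continuous_real)
qed

lemma entropy_balance:
  assumes t: "t \<in> I"
  shows "integral {0..1} (entropy_rate t) = integral {0..1} (source t)
    - 4 * \<mu> * \<sigma> * integral {0..1} (capillary_dissipation h t)"
proof -
  let ?F = "\<lambda>r. entropy_rate t r + 4 * \<mu> * \<sigma> * capillary_dissipation h t r - source t r"
  have "(?F has_integral entropy_flux t 1 - entropy_flux t 0) {0..1}"
  proof (rule fundamental_theorem_of_calculus_interior)
    fix r :: real assume r: "r \<in> {0<..<1}"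
    then show "(entropy_flux t has_vector_derivative ?F r) (at r)"
      using entropy_flux_deriv[OF t r] dr_r_h1[OF t, of r]
      by (simp add: has_vector_derivative_iff_real capillary_dissipation_def)
  qed (use continuous_entropy_flux[OF t] in auto)
  then have "integral {0..1} ?F = 0"
    by (simp add: entropy_flux_boundary[OF t] integral_unique)
  moreover have "integral {0..1} ?F = integral {0..1} (entropy_rate t)
    + 4 * \<mu> * \<sigma> * integral {0..1} (capillary_dissipation h t) - integral {0..1} (source t)"
    by (intro integral_unique has_integral_add has_integral_diff has_integral_mult_right
        integrable_integral integrable_energy_terms integrable_entropy_terms t)
  ultimately show ?thesis by simp
qed

end

section \<open>Absorbing the source into the dissipation\<close>

text \<open>
  If \<open>\<bar>g\<bar>\<close> exceeds \<open>\<kappa> / r\<close>, then \<open>1 < (r \<bar>g\<bar> / \<kappa>)\<^sup>3\<close>, and multiplying \<open>\<bar>g\<bar>\<close> by this factor leaves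
  \<open>g\<^sup>4 r\<^sup>3 / \<kappa>\<^sup>3\<close>. Times \<open>h v\<^sup>2\<close>, the first summand is controlled by the integral of \<open>h v\<^sup>2 / r\<close> and
  the second by the kinetic energy, with the factor \<open>J\<^sup>2\<close> that the dissipation controls. This replaces
  the Hoelder and Young inequalities with exponents 4 and 4/3.
\<close>

lemma abs_le_split_at_scale:
  fixes r g J \<kappa> :: real
  assumes "r > 0" "\<kappa> > 0" "r * g\<^sup>2 \<le> J"
  shows "\<bar>g\<bar> \<le> \<kappa> / r + J\<^sup>2 / \<kappa> ^ 3 * r"
proof (cases "\<bar>g\<bar> * r \<le> \<kappa>")
  case True
  then have "\<bar>g\<bar> \<le> \<kappa> / r"
    using assms by (simp add: field_simps)
  also have "\<dots> \<le> \<kappa> / r + J\<^sup>2 / \<kappa> ^ 3 * r"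
    using assms by simp
  finally show ?thesis .
next
  case False
  then have "\<kappa> ^ 3 \<le> (\<bar>g\<bar> * r) ^ 3"
    using assms by (intro power_mono) auto
  then have "\<bar>g\<bar> * \<kappa> ^ 3 \<le> \<bar>g\<bar> * (\<bar>g\<bar> * r) ^ 3"
    by (intro mult_left_mono) auto
  also have "\<dots> = (r * \<bar>g\<bar>\<^sup>2)\<^sup>2 * r"
    by (simp only: power2_eq_square power3_eq_cube mult_ac)
  also have "\<dots> \<le> J\<^sup>2 * r"
    using assms by (intro mult_right_mono power_mono) auto
  finally have "\<bar>g\<bar> \<le> J\<^sup>2 / \<kappa> ^ 3 * r"
    using assms by (simp add: field_simps)
  also have "\<dots> \<le> \<kappa> / r + J\<^sup>2 / \<kappa> ^ 3 * r"
    using assms by simp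
  finally show ?thesis .
qed

text \<open>
  The quadratic term is split by \<open>2 a b \<le> a\<^sup>2 + b\<^sup>2\<close> into \<open>\<epsilon> r g\<^sup>4 \<le> \<epsilon> J g\<^sup>2\<close> and a multiple of
  \<open>V\<^sup>2 / (r H\<^sup>2)\<close>; trading \<open>1 / H\<^sup>2\<close> for \<open>H / m\<^sup>3\<close> is where the third power of \<open>m\<close> arises.
\<close>

lemma source_bound:
  fixes r H g V J m \<mu> \<kappa> \<epsilon> :: real
  assumes r: "r > 0" and \<kappa>: "\<kappa> > 0" and J: "r * g\<^sup>2 \<le> J" and m: "m > 0" "H \<ge> m"
    and \<mu>: "\<mu> > 0" and \<epsilon>: "\<epsilon> > 0"
  shows "2 * \<mu> * (g * V\<^sup>2) + 8 * \<mu>\<^sup>2 * (V * g\<^sup>2 / H)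
    \<le> (2 * \<mu> * \<kappa> / m + 16 * \<mu> ^ 4 / (\<epsilon> * m ^ 3)) * (H * V\<^sup>2 / r)
      + 2 * \<mu> * J\<^sup>2 / (\<kappa> ^ 3 * m) * (r * H * V\<^sup>2) + \<epsilon> * J * g\<^sup>2"
proof -
  have H: "H > 0" using m by simp
  have "g * V\<^sup>2 \<le> \<bar>g\<bar> * V\<^sup>2"
    by (intro mult_right_mono) auto
  also have "\<dots> \<le> (\<kappa> / r + J\<^sup>2 / \<kappa> ^ 3 * r) * V\<^sup>2"
    by (intro mult_right_mono abs_le_split_at_scale r \<kappa> J) simp
  also have "\<dots> \<le> (\<kappa> / r + J\<^sup>2 / \<kappa> ^ 3 * r) * (H * V\<^sup>2 / m)"
  proof (rule mult_left_mono)
    have "m * V\<^sup>2 \<le> H * V\<^sup>2"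
      using m by (intro mult_right_mono) auto
    then show "V\<^sup>2 \<le> H * V\<^sup>2 / m"
      using m by (simp add: field_simps)
  qed (use r \<kappa> in simp)
  finally have 1: "2 * \<mu> * (g * V\<^sup>2) \<le> 2 * \<mu> * ((\<kappa> / r + J\<^sup>2 / \<kappa> ^ 3 * r) * (H * V\<^sup>2 / m))"
    by (rule mult_left_mono) (use \<mu> in simp)
  have "8 * \<mu>\<^sup>2 * (V * g\<^sup>2 / H) \<le> \<epsilon> * r * g ^ 4 + 16 * \<mu> ^ 4 / \<epsilon> * (V\<^sup>2 / (r * H\<^sup>2))"
  proof -
    have "0 \<le> (\<epsilon> * r * g\<^sup>2 - 4 * \<mu>\<^sup>2 * V / H)\<^sup>2 / (\<epsilon> * r)"
      using \<epsilon> r by simp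
    also have "\<dots> = \<epsilon> * r * g ^ 4 + 16 * \<mu> ^ 4 / \<epsilon> * (V\<^sup>2 / (r * H\<^sup>2)) - 8 * \<mu>\<^sup>2 * (V * g\<^sup>2 / H)"
      using \<epsilon> r H by (simp add: field_simps power2_eq_square power4_eq_xxxx)
    finally show ?thesis by simp
  qed
  also have "\<epsilon> * r * g ^ 4 \<le> \<epsilon> * J * g\<^sup>2"
  proof -
    have "\<epsilon> * g\<^sup>2 * (r * g\<^sup>2) \<le> \<epsilon> * g\<^sup>2 * J"
      using \<epsilon> J by (intro mult_left_mono) auto
    then show ?thesis by (simp add: power2_eq_square power4_eq_xxxx mult_ac)
  qed
  also have "16 * \<mu> ^ 4 / \<epsilon> * (V\<^sup>2 / (r * H\<^sup>2)) \<le> 16 * \<mu> ^ 4 / \<epsilon> * (H * V\<^sup>2 / (r * m ^ 3))"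
  proof (rule mult_left_mono)
    have "m ^ 3 \<le> H ^ 3"
      using m by (intro power_mono) auto
    then have "V\<^sup>2 / (r * H\<^sup>2) * m ^ 3 \<le> V\<^sup>2 / (r * H\<^sup>2) * H ^ 3"
      using r by (intro mult_left_mono) auto
    also have "\<dots> = V\<^sup>2 * H / r"
      using H by (simp add: power2_eq_square power3_eq_cube)
    finally show "V\<^sup>2 / (r * H\<^sup>2) \<le> H * V\<^sup>2 / (r * m ^ 3)"
      using m by (simp add: pos_le_divide_eq mult.commute flip: divide_divide_eq_left)
  qed (use \<epsilon> in simp)
  finally have 2: "8 * \<mu>\<^sup>2 * (V * g\<^sup>2 / H) \<le> \<epsilon> * J * g\<^sup>2 + 16 * \<mu> ^ 4 / \<epsilon> * (H * V\<^sup>2 / (r * m ^ 3))"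
    by simp
  show ?thesis
    using add_mono[OF 1 2] by (simp add: algebra_simps)
qed

context thick_sheet
begin

lemma energy_bounds:
  assumes t: "t \<in> I" and e: "integral {0..1} (energy_density \<sigma> h v t) \<le> e"
  shows "integral {0..1} (\<lambda>r. r * h r t * (v r t)\<^sup>2) \<le> 2 * e"
    "integral {0..1} (\<lambda>r. r * (h1 r t)\<^sup>2) \<le> 2 * e / \<sigma>"
proof -
  have int: "(\<lambda>r. r * h r t * (v r t)\<^sup>2) integrable_on {0..1}" "(\<lambda>r. r * (h1 r t)\<^sup>2) integrable_on {0..1}"
    using t by (intro integrable_continuous_real continuous_intros cont_rt; auto)+
  have "integral {0..1} (\<lambda>r. 1 / 2 * (r * h r t * (v r t)\<^sup>2) + \<sigma> / 2 * (r * (h1 r t)\<^sup>2))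
    = 1 / 2 * integral {0..1} (\<lambda>r. r * h r t * (v r t)\<^sup>2) + \<sigma> / 2 * integral {0..1} (\<lambda>r. r * (h1 r t)\<^sup>2)"
    by (intro integral_unique has_integral_add has_integral_mult_right integrable_integral int)
  also have "(\<lambda>r. 1 / 2 * (r * h r t * (v r t)\<^sup>2) + \<sigma> / 2 * (r * (h1 r t)\<^sup>2)) = energy_density \<sigma> h v t"
    by (auto simp: energy_density_def algebra_simps)
  finally have "1 / 2 * integral {0..1} (\<lambda>r. r * h r t * (v r t)\<^sup>2)
    + \<sigma> / 2 * integral {0..1} (\<lambda>r. r * (h1 r t)\<^sup>2) \<le> e"
    using e by simp
  moreover have "0 \<le> integral {0..1} (\<lambda>r. r * h r t * (v r t)\<^sup>2)"
    "0 \<le> integral {0..1} (\<lambda>r. r * (h1 r t)\<^sup>2)"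
    using h_nonneg[OF t] by (intro integral_nonneg int; simp)+
  moreover have "0 \<le> \<sigma> * integral {0..1} (\<lambda>r. r * (h1 r t)\<^sup>2)"
    using calculation(3) \<sigma>_pos by simp
  ultimately have "integral {0..1} (\<lambda>r. r * h r t * (v r t)\<^sup>2) \<le> 2 * e"
    "\<sigma> * integral {0..1} (\<lambda>r. r * (h1 r t)\<^sup>2) \<le> 2 * e"
    by linarith+
  then show "integral {0..1} (\<lambda>r. r * h r t * (v r t)\<^sup>2) \<le> 2 * e"
    "integral {0..1} (\<lambda>r. r * (h1 r t)\<^sup>2) \<le> 2 * e / \<sigma>"
    using \<sigma>_pos by (simp_all add: pos_le_divide_eq mult.commute)
qed

text \<open>
  The scale \<open>\<kappa> = K / m\<^sup>2\<close> is chosen so that \<open>\<kappa> / m\<close> has the order \<open>1 / m\<^sup>3\<close>; the condition on \<open>K\<close>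
  makes it large enough for the kinetic part to use at most a quarter of the dissipation
  \<open>4 \<mu> \<sigma> Y\<close>. The weight \<open>\<epsilon> = \<sigma>\<^sup>2 \<mu> / (8 e)\<close> lets the quadratic part use another quarter.
\<close>

lemma source_le:
  fixes e K :: real
  assumes t: "t \<in> I" and e: "integral {0..1} (energy_density \<sigma> h v t) \<le> e" "e > 0"
    and K: "K > 0" "32 * e\<^sup>2 * m ^ 5 \<le> \<sigma>\<^sup>2 * K ^ 3"
  shows "integral {0..1} (source t)
    \<le> (2 * \<mu> * K + 128 * \<mu> ^ 3 * e / \<sigma>\<^sup>2) / m ^ 3 * integral {0..1} (remainder_density h v t)
      + 2 * \<mu> * \<sigma> * integral {0..1} (capillary_dissipation h t)"
proof -
  let ?R = "integral {0..1} (remainder_density h v t)"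
    and ?Y = "integral {0..1} (capillary_dissipation h t)"
  obtain J where J: "J \<ge> 0" "\<And>r. r \<in> {0..1} \<Longrightarrow> r * (h1 r t)\<^sup>2 \<le> J"
    "integral {0..1} (\<lambda>r. (h1 r t)\<^sup>2) \<le> J"
    "J\<^sup>2 \<le> 4 * integral {0..1} (\<lambda>r. r * (h1 r t)\<^sup>2) * integral {0..1} (\<lambda>r. r * (h2 r t + slope h1 r t)\<^sup>2)"
  proof (rule radial_interpolation[of "\<lambda>r. h1 r t" "\<lambda>r. h2 r t" "\<lambda>r. slope h1 r t"])
    show "continuous_on {0..1} (\<lambda>r. h2 r t)" "continuous_on {0..1} (\<lambda>r. slope h1 r t)"
      using t by (intro cont_rt continuous_intros; auto)+
    show "h1 r t = r * slope h1 r t" for r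
      using boundary[OF t] by (simp add: mult_slope)
  qed (use deriv_r(2)[OF t] boundary[OF t] in auto)
  have Y: "?Y = integral {0..1} (\<lambda>r. r * (h2 r t + slope h1 r t)\<^sup>2)"
    by (intro integral_cong dissipation_eq t)
  have Y0: "0 \<le> ?Y"
    by (intro integral_nonneg integrable_energy_terms t) (auto simp: capillary_dissipation_def)
  have JY: "J\<^sup>2 \<le> 8 * e / \<sigma> * ?Y"
  proof -
    have "4 * integral {0..1} (\<lambda>r. r * (h1 r t)\<^sup>2) * ?Y \<le> 4 * (2 * e / \<sigma>) * ?Y"
      using Y0 energy_bounds[OF t e(1)] by (intro mult_right_mono mult_left_mono) auto
    then show ?thesis using J(4) Y by simp
  qed
  define \<kappa> where "\<kappa> = K / m\<^sup>2"
  define \<epsilon> where "\<epsilon> = \<sigma>\<^sup>2 * \<mu> / (8 * e)"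
  have \<kappa>: "\<kappa> > 0" and \<epsilon>: "\<epsilon> > 0"
    using K m_pos e \<sigma>_pos \<mu>_pos by (simp_all add: \<kappa>_def \<epsilon>_def)
  let ?a = "2 * \<mu> * \<kappa> / m + 16 * \<mu> ^ 4 / (\<epsilon> * m ^ 3)" and ?b = "2 * \<mu> * J\<^sup>2 / (\<kappa> ^ 3 * m)"
  have int: "(\<lambda>r. r * h r t * (v r t)\<^sup>2) integrable_on {0..1}" "(\<lambda>r. (h1 r t)\<^sup>2) integrable_on {0..1}"
    using t by (intro integrable_continuous_real continuous_intros cont_rt; auto)+
  have "((\<lambda>r. ?a * remainder_density h v t r + ?b * (r * h r t * (v r t)\<^sup>2) + \<epsilon> * J * (h1 r t)\<^sup>2)
    has_integral ?a * ?R + ?b * integral {0..1} (\<lambda>r. r * h r t * (v r t)\<^sup>2)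
      + \<epsilon> * J * integral {0..1} (\<lambda>r. (h1 r t)\<^sup>2)) {0..1}"
    by (intro has_integral_add has_integral_mult_right integrable_integral int integrable_energy_terms t)
  moreover have "source t r \<le> ?a * remainder_density h v t r + ?b * (r * h r t * (v r t)\<^sup>2)
      + \<epsilon> * J * (h1 r t)\<^sup>2" if r: "r \<in> {0..1}" for r
  proof (cases "r = 0")
    case True
    then show ?thesis
      using boundary[OF t] by (simp add: remainder_density_def)
  next
    case False
    then show ?thesis
      unfolding remainder_density_def
      using r by (intro source_bound \<kappa> \<epsilon> J \<mu>_pos m_pos h_ge t) auto
  qed
  ultimately have "integral {0..1} (source t) \<le> ?a * ?R + ?b * integral {0..1} (\<lambda>r. r * h r t * (v r t)\<^sup>2)
      + \<epsilon> * J * integral {0..1} (\<lambda>r. (h1 r t)\<^sup>2)"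
    by (rule has_integral_le[OF integrable_integral[OF integrable_entropy_terms(3)[OF t]]])
  also have "?b * integral {0..1} (\<lambda>r. r * h r t * (v r t)\<^sup>2) \<le> \<mu> * \<sigma> * ?Y"
  proof -
    have "?b * integral {0..1} (\<lambda>r. r * h r t * (v r t)\<^sup>2) \<le> ?b * (2 * e)"
      using energy_bounds[OF t e(1)] \<mu>_pos \<kappa> m_pos by (intro mult_left_mono) auto
    also have "\<dots> = 4 * \<mu> * e / (\<kappa> ^ 3 * m) * J\<^sup>2"
      by simp
    also have "\<dots> \<le> 4 * \<mu> * e / (\<kappa> ^ 3 * m) * (8 * e / \<sigma> * ?Y)"
      using JY \<mu>_pos e \<kappa> m_pos by (intro mult_left_mono) auto
    also have "\<dots> = 32 * e\<^sup>2 * m ^ 5 / (\<sigma>\<^sup>2 * K ^ 3) * (\<mu> * \<sigma> * ?Y)"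
      using m_pos K \<sigma>_pos unfolding \<kappa>_def
      by (simp add: field_simps power2_eq_square power3_eq_cube eval_nat_numeral)
    also have "\<dots> \<le> 1 * (\<mu> * \<sigma> * ?Y)"
      using K \<sigma>_pos \<mu>_pos Y0 by (intro mult_right_mono) (auto simp: divide_le_eq)
    finally show ?thesis by simp
  qed
  also have "\<epsilon> * J * integral {0..1} (\<lambda>r. (h1 r t)\<^sup>2) \<le> \<mu> * \<sigma> * ?Y"
  proof -
    have "\<epsilon> * J * integral {0..1} (\<lambda>r. (h1 r t)\<^sup>2) \<le> \<epsilon> * J * J"
      using J \<epsilon> by (intro mult_left_mono) auto
    also have "\<dots> = \<epsilon> * J\<^sup>2"
      by (simp add: power2_eq_square)
    also have "\<dots> \<le> \<epsilon> * (8 * e / \<sigma> * ?Y)"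
      using JY \<epsilon> by (intro mult_left_mono) auto
    also have "\<dots> = \<mu> * \<sigma> * ?Y"
      using e \<sigma>_pos by (simp add: \<epsilon>_def power2_eq_square)
    finally show ?thesis .
  qed
  also have "?a = (2 * \<mu> * K + 128 * \<mu> ^ 3 * e / \<sigma>\<^sup>2) / m ^ 3"
    using m_pos e \<sigma>_pos \<mu>_pos unfolding \<kappa>_def \<epsilon>_def
    by (simp add: field_simps power2_eq_square power3_eq_cube power4_eq_xxxx)
  finally show ?thesis by simp
qed

end

section \<open>Energy and entropy inequalities\<close>

theorem lemmaA1:
  fixes \<sigma> \<mu> :: real and h0 v0 :: "real \<Rightarrow> real"
  assumes "\<sigma> > 0" and "\<mu> > 0"
  shows "\<exists>C>0. \<forall>T>0. \<forall>h v. classical_positive_solution \<sigma> \<mu> T h0 v0 h v \<longrightarrow>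
    (\<forall>t\<in>{0<..<T}.
       energy_density \<sigma> h v t integrable_on {0..1} \<and>
       viscous_dissipation h v t integrable_on {0..1} \<and>
       (\<lambda>s. integral {0..1} (energy_density \<sigma> h v s)) differentiable (at t) \<and>
       deriv (\<lambda>s. integral {0..1} (energy_density \<sigma> h v s)) t
         \<le> - 2 * \<mu> * integral {0..1} (viscous_dissipation h v t)) \<and>
    (\<forall>m>0. (\<forall>r\<in>{0<..<1}. \<forall>t\<in>{0..<T}. h r t \<ge> m) \<longrightarrow>
      (\<forall>t\<in>{0<..<T}.
         entropy_density \<sigma> \<mu> h v t integrable_on {0..1} \<and>
         capillary_dissipation h t integrable_on {0..1} \<and>
         remainder_density h v t integrable_on {0..1} \<and>
         (\<lambda>s. integral {0..1} (entropy_density \<sigma> \<mu> h v s)) differentiable (at t) \<and>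
         deriv (\<lambda>s. integral {0..1} (entropy_density \<sigma> \<mu> h v s)) t
           \<le> - 2 * \<mu> * \<sigma> * integral {0..1} (capillary_dissipation h t)
             + C / (\<mu> * \<sigma> * m ^ 3) * integral {0..1} (remainder_density h v t)))"
proof -
  \<comment> \<open>Absolute values and the summand 1 keep the constants positive for arbitrary data.\<close>
  define e where "e = \<bar>integral {0..1} (energy_density \<sigma> (\<lambda>r t. h0 r) (\<lambda>r t. v0 r) 0)\<bar> + 1"
  define K where "K = 1 + 32 * e\<^sup>2 * \<bar>h0 (1 / 2)\<bar> ^ 5 / \<sigma>\<^sup>2"
  define C where "C = \<mu> * \<sigma> * (2 * \<mu> * K + 128 * \<mu> ^ 3 * e / \<sigma>\<^sup>2)"
  have e: "e > 0" by (simp add: e_def)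
  have K: "K \<ge> 1" by (simp add: K_def)
  have C: "C > 0"
    unfolding C_def using assms e K by (intro mult_pos_pos add_pos_pos divide_pos_pos) auto
  have "(\<forall>t\<in>{0<..<T}.
       energy_density \<sigma> h v t integrable_on {0..1} \<and>
       viscous_dissipation h v t integrable_on {0..1} \<and>
       (\<lambda>s. integral {0..1} (energy_density \<sigma> h v s)) differentiable (at t) \<and>
       deriv (\<lambda>s. integral {0..1} (energy_density \<sigma> h v s)) t
         \<le> - 2 * \<mu> * integral {0..1} (viscous_dissipation h v t))" (is ?energy)
    and "(\<forall>m>0. (\<forall>r\<in>{0<..<1}. \<forall>t\<in>{0..<T}. h r t \<ge> m) \<longrightarrow>
      (\<forall>t\<in>{0<..<T}.
         entropy_density \<sigma> \<mu> h v t integrable_on {0..1} \<and>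
         capillary_dissipation h t integrable_on {0..1} \<and>
         remainder_density h v t integrable_on {0..1} \<and>
         (\<lambda>s. integral {0..1} (entropy_density \<sigma> \<mu> h v s)) differentiable (at t) \<and>
         deriv (\<lambda>s. integral {0..1} (entropy_density \<sigma> \<mu> h v s)) t
           \<le> - 2 * \<mu> * \<sigma> * integral {0..1} (capillary_dissipation h t)
             + C / (\<mu> * \<sigma> * m ^ 3) * integral {0..1} (remainder_density h v t)))" (is ?entropy)
    if "T > 0" and sol: "classical_positive_solution \<sigma> \<mu> T h0 v0 h v" for T h v
  proof -
    interpret viscous_sheet \<sigma> \<mu> T h0 v0 h v
      by unfold_locales (fact assms that)+
    show ?energy
    proof (intro ballI conjI)
      fix t assume t: "t \<in> I"
      note D = deriv_energy[OF t]
      show "(\<lambda>s. integral {0..1} (energy_density \<sigma> h v s)) differentiable (at t)"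
        using D real_differentiable_def by blast
      show "deriv (\<lambda>s. integral {0..1} (energy_density \<sigma> h v s)) t
         \<le> - 2 * \<mu> * integral {0..1} (viscous_dissipation h v t)"
        using energy_rate_le[OF t] unfolding DERIV_imp_deriv[OF D] .
    qed (intro integrable_energy_terms; assumption)+
    show ?entropy
    proof (intro allI impI ballI conjI)
      fix m t :: real assume m: "m > 0" and hm: "\<forall>r\<in>{0<..<1}. \<forall>t\<in>{0..<T}. m \<le> h r t" and t: "t \<in> I"
      interpret thick_sheet \<sigma> \<mu> T h0 v0 h v m
        by unfold_locales (use m hm in auto)
      note D = deriv_entropy[OF t]
      show "(\<lambda>s. integral {0..1} (entropy_density \<sigma> \<mu> h v s)) differentiable (at t)"
        using D real_differentiable_def by blast
      have E: "integral {0..1} (energy_density \<sigma> h v t) \<le> e"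
        using energy_le_initial[OF t] by (simp add: e_def)
      \<comment> \<open>The lower bound includes the initial time, so \<open>m\<close> is bounded in terms of the data.\<close>
      have "m \<le> \<bar>h0 (1 / 2)\<bar>"
        using hm[rule_format, of "1 / 2" 0] sol \<open>T > 0\<close> by (auto simp: classical_positive_solution_def)
      then have "32 * e\<^sup>2 * m ^ 5 \<le> 32 * e\<^sup>2 * \<bar>h0 (1 / 2)\<bar> ^ 5"
        using m by (intro mult_left_mono power_mono) auto
      also have "\<dots> \<le> \<sigma>\<^sup>2 * K"
        using assms by (simp add: K_def field_simps)
      also have "\<dots> \<le> \<sigma>\<^sup>2 * K ^ 3"
        using K power_increasing[of 1 3 K] by (intro mult_left_mono) auto
      finally have "32 * e\<^sup>2 * m ^ 5 \<le> \<sigma>\<^sup>2 * K ^ 3" .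
      from source_le[OF t E e _ this] K
      have "integral {0..1} (source t) \<le> C / (\<mu> * \<sigma> * m ^ 3) * integral {0..1} (remainder_density h v t)
        + 2 * \<mu> * \<sigma> * integral {0..1} (capillary_dissipation h t)"
        using assms by (simp add: C_def)
      then show "deriv (\<lambda>s. integral {0..1} (entropy_density \<sigma> \<mu> h v s)) t
           \<le> - 2 * \<mu> * \<sigma> * integral {0..1} (capillary_dissipation h t)
             + C / (\<mu> * \<sigma> * m ^ 3) * integral {0..1} (remainder_density h v t)"
        unfolding DERIV_imp_deriv[OF D] entropy_balance[OF t] by simp
      show "entropy_density \<sigma> \<mu> h v t integrable_on {0..1}"
        by (rule integrable_entropy_terms[OF t])
    qed (intro integrable_energy_terms; assumption)+
  qed
  then show ?thesis using C by blast
qed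

end
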